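(* Let $0\le\delta<1$, $\varphi\in\mathcal{S}^*(\delta)$, $\theta\in[0,\pi)$, and let $F^\theta_{\alpha\beta}$ be a sense-preserving harmonic mapping in $\mathbb{D}$ which is the horizontal shear of $C^\theta_{\alpha\beta}[\varphi]$ with dilatation $w_{\alpha\beta}=\alpha(1+\beta)w$. Then $F^\theta_{\alpha\beta}\in\mathcal{SHU}$ for all non-negative $\alpha,\beta$ satisfying $$\alpha\le\frac{1}{2\Big(2+\beta+(1+\beta)\|w^*\|(1+\|w\|)\Big)}.$$
   Context: $\mathbb{D}=\{z\in\mathbb{C}:|z|<1\}$, $\mathbb{T}=\{z:|z|=1\}$. For $0\le\delta<1$, $\mathcal{S}^*(\delta)$ is the class of analytic functions $\varphi$ in $\mathbb{D}$ with $\varphi(0)=0$, $\varphi'(0)=1$ and $\mathrm{Re}\,[z\varphi'(z)/\varphi(z)]>\delta$ for all $z\in\mathbb{D}$. Define $$C_{\alpha\beta}[\varphi](z)=\int_0^z\Big(\frac{\varphi(\zeta)}{\zeta(1-\zeta)^{\beta}}\Big)^{\alpha}\,d\zeta,\qquad C^\theta_{\alpha\beta}[\varphi](z)=e^{-i\theta}C_{\alpha\beta}[\varphi](e^{i\theta}z),\qquad z\in\mathbb{D},$$ with the analytic branches of the powers for which the integrand equals $1$ at $\zeta=0$. Let $w$ be an analytic function in $\mathbb{D}$ with $|w(z)|<1$, and $w_{\alpha\beta}(z)=\alpha(1+\beta)w(z)$. The horizontal shear of $C^\theta_{\alpha\beta}[\varphi]$ with dilatation $w_{\alpha\beta}$ is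 the harmonic mapping $F^\theta_{\alpha\beta}=H+\overline{G}$, with $H,G$ analytic in $\mathbb{D}$, $H-G=C^\theta_{\alpha\beta}[\varphi]$, $G'=w_{\alpha\beta}H'$, and normalization $H(0)=G(0)=0$, $H'(0)=1$, $G'(0)=0$. It is sense-preserving if $|H'|^2-|G'|^2>0$ (equivalently $|w_{\alpha\beta}|<1$) in $\mathbb{D}$. $\|w\|=\sup_{z\in\mathbb{D}}|w(z)|$ and $\|w^*\|=\sup_{z\in\mathbb{D}}\frac{|w'(z)|(1-|z|^2)}{1-|w(z)|^2}$. A sense-preserving harmonic mapping $f=h+\overline{g}$ in $\mathbb{D}$ is stable harmonic univalent, written $f\in\mathcal{SHU}$, if all mappings $f_\lambda=h+\lambda\overline{g}$, $\lambda\in\mathbb{T}$, are univalent in $\mathbb{D}$. *)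

theory Defs
  imports "HOL-Complex_Analysis.Complex_Analysis"
begin

abbreviation unit_disc :: "complex set" (\<open>\<D>\<close>)
  where "\<D> \<equiv> ball 0 1"

abbreviation unit_circle :: "complex set" (\<open>\<T>\<close>)
  where "\<T> \<equiv> sphere 0 1"

(* At z = 0 the quotient has a removable singularity with value 1 > \<delta>, so only z \<noteq> 0 is
   constrained. For \<delta> \<ge> 0 the condition also forces \<phi> z \<noteq> 0 there, since x / 0 = 0. *)
definition starlike_class :: "real \<Rightarrow> (complex \<Rightarrow> complex) set"
  where "starlike_class \<delta> =
    {\<phi>. \<phi> holomorphic_on \<D> \<and> \<phi> 0 = 0 \<and> deriv \<phi> 0 = 1 \<and>
        (\<forall>z\<in>\<D> - {0}. Re (z * deriv \<phi> z / \<phi> z) > \<delta>)}"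

(* If f is holomorphic and zero-free in \<D> with f 0 = 1, such an L exists and is unique on \<D>. *)
definition disc_log :: "(complex \<Rightarrow> complex) \<Rightarrow> complex \<Rightarrow> complex"
  where "disc_log f =
    (SOME L. L holomorphic_on \<D> \<and> L 0 = 0 \<and> (\<forall>z\<in>\<D>. exp (L z) = f z))"

(* The analytic branch in \<D> of f^a with value 1 at 0. *)
definition disc_power :: "(complex \<Rightarrow> complex) \<Rightarrow> real \<Rightarrow> complex \<Rightarrow> complex"
  where "disc_power f a z = exp (of_real a * disc_log f z)"

(* \<phi>(\<zeta>) / (\<zeta> (1 - \<zeta>)^\<beta>), with the removable singularity of \<phi>(\<zeta>) / \<zeta> at 0 filled in. *)
definition C_base :: "real \<Rightarrow> (complex \<Rightarrow> complex) \<Rightarrow> complex \<Rightarrow> complex"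
  where "C_base \<beta> \<phi> \<zeta> =
    (if \<zeta> = 0 then deriv \<phi> 0 else \<phi> \<zeta> / \<zeta>) / disc_power (\<lambda>u. 1 - u) \<beta> \<zeta>"

definition C_transform ::
    "real \<Rightarrow> real \<Rightarrow> (complex \<Rightarrow> complex) \<Rightarrow> complex \<Rightarrow> complex"
  where "C_transform \<alpha> \<beta> \<phi> z =
    contour_integral (linepath 0 z) (disc_power (C_base \<beta> \<phi>) \<alpha>)"

definition C_transform_rot ::
    "real \<Rightarrow> real \<Rightarrow> real \<Rightarrow> (complex \<Rightarrow> complex) \<Rightarrow> complex \<Rightarrow> complex"
  where "C_transform_rot \<theta> \<alpha> \<beta> \<phi> z =
    exp (- \<i> * of_real \<theta>) * C_transform \<alpha> \<beta> \<phi> (exp (\<i> * of_real \<theta>) * z)"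

definition harmonic_decomp ::
    "(complex \<Rightarrow> complex) \<Rightarrow> (complex \<Rightarrow> complex) \<Rightarrow> (complex \<Rightarrow> complex) \<Rightarrow> bool"
  where "harmonic_decomp f h g \<longleftrightarrow>
    h holomorphic_on \<D> \<and> g holomorphic_on \<D> \<and> (\<forall>z\<in>\<D>. f z = h z + cnj (g z))"

definition sense_preserving :: "(complex \<Rightarrow> complex) \<Rightarrow> (complex \<Rightarrow> complex) \<Rightarrow> bool"
  where "sense_preserving h g \<longleftrightarrow>
    (\<forall>z\<in>\<D>. (cmod (deriv h z))\<^sup>2 - (cmod (deriv g z))\<^sup>2 > 0)"

(* The decomposition f = h + cnj g is unique up to an additive constant in h and g; such a
   constant only translates h + \<mu> cnj g, so the choice of decomposition is immaterial. *)
definition SHU :: "(complex \<Rightarrow> complex) set"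
  where "SHU =
    {f. \<exists>h g. harmonic_decomp f h g \<and> sense_preserving h g \<and>
        (\<forall>\<mu>\<in>\<T>. inj_on (\<lambda>z. h z + \<mu> * cnj (g z)) \<D>)}"

(* F = H + cnj G is the horizontal shear of \<Phi> with dilatation \<omega>. *)
definition horizontal_shear ::
    "(complex \<Rightarrow> complex) \<Rightarrow> (complex \<Rightarrow> complex) \<Rightarrow>
     (complex \<Rightarrow> complex) \<Rightarrow> (complex \<Rightarrow> complex) \<Rightarrow> (complex \<Rightarrow> complex) \<Rightarrow> bool"
  where "horizontal_shear \<Phi> \<omega> F H G \<longleftrightarrow>
    harmonic_decomp F H G \<and>
    (\<forall>z\<in>\<D>. H z - G z = \<Phi> z) \<and>
    (\<forall>z\<in>\<D>. deriv G z = \<omega> z * deriv H z) \<and>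
    H 0 = 0 \<and> G 0 = 0 \<and> deriv H 0 = 1 \<and> deriv G 0 = 0"

(* For holomorphic w with |w| < 1 in \<D>, both suprema are over sets bounded by 1
   (the second by the Schwarz-Pick lemma), so the real-valued SUP is the genuine supremum. *)
definition disc_sup_norm :: "(complex \<Rightarrow> complex) \<Rightarrow> real"
  where "disc_sup_norm w = (SUP z\<in>\<D>. cmod (w z))"

definition hyperbolic_norm :: "(complex \<Rightarrow> complex) \<Rightarrow> real"
  where "hyperbolic_norm w =
    (SUP z\<in>\<D>. cmod (deriv w z) * (1 - (cmod z)\<^sup>2) / (1 - (cmod (w z))\<^sup>2))"

end

theory Submission
  imports Defs
begin

text \<open>
  A horizontal shear \<open>H + cnj G\<close> is stable harmonic univalent as soon as every analytic function
  \<open>f = H + c * G\<close> with \<open>norm c = 1\<close> is univalent (\<open>stable_injectivity\<close>). Univalence of \<open>f\<close> follows from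
  Becker's criterion: \<open>(1 - (norm z)\<^sup>2) * norm (z * f'' z / f' z) \<le> 1\<close> suffices.

  The shear equations give \<open>f' = \<Phi>' * (1 + c * \<omega>) / (1 - \<omega>)\<close>, where \<open>\<Phi>\<close> is the rotated transform and
  \<open>\<omega> = \<alpha> * (1 + \<beta>) * w\<close>. So \<open>f'' / f'\<close> splits into three terms. The logarithmic derivative of \<open>\<Phi>'\<close> is
  \<open>\<alpha>\<close> times \<open>\<phi>' / \<phi> - 1 / \<zeta> + \<beta> / (1 - \<zeta>)\<close> at the rotated point \<open>\<zeta>\<close>, up to a unimodular factor, and
  Caratheodory's bound for functions of positive real part yields the contribution \<open>2 * \<alpha> * (2 + \<beta>)\<close>
  (\<open>C_base_log_derivative_bound\<close>). Each of the other two terms contributes at most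
  \<open>\<alpha> * (1 + \<beta>) * hyperbolic_norm w * (1 + disc_sup_norm w)\<close> (\<open>dilatation_term_bound\<close>). The bound on \<open>\<alpha>\<close>
  says exactly that these contributions add up to at most \<open>1\<close>.

  Becker's criterion is proved with the Loewner chain
  \<open>f (q * z) + (1 / q - q) * z * f' (q * z)\<close>, \<open>0 < q \<le> 1\<close>, but without solving a differential equation.
  For small \<open>q\<close> the chain is, up to scaling, nearly \<open>z \<mapsto> f' 0 * z\<close>, hence injective on the closed disc. Injectivity cannot be
  lost as \<open>q\<close> grows to \<open>1\<close>: at the first parameter where two points have the same image, positivity of
  the real part in the Loewner equation means that the roots of this common value move into the disc
  when \<open>q\<close> decreases, so injectivity would already have failed earlier
  (\<open>compact_noninjective_parameters\<close>, \<open>root_moves_inward\<close>, \<open>Becker_closed_disc\<close>).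
\<close>

section \<open>Univalence along a Loewner chain\<close>

text \<open>
  Non-injectivity survives limits. If \<open>K t\<close> identifies \<open>a \<noteq> b\<close> and \<open>t\<close> converges, the points \<open>a\<close>, \<open>b\<close>
  subconverge. They cannot merge: near their common limit the derivative of \<open>K t\<close> is close to one
  fixed non-zero number \<open>D\<close>, uniformly in \<open>t\<close>, so \<open>K t\<close> is injective there.
\<close>

lemma compact_noninjective_parameters:
  fixes K K' :: "'a::metric_space \<Rightarrow> 'b::real_normed_field \<Rightarrow> 'b"
  assumes T: "compact T" and S: "compact S" "convex S"
    and contK: "continuous_on (T \<times> S) (\<lambda>(t, z). K t z)"
    and contK': "continuous_on (T \<times> S) (\<lambda>(t, z). K' t z)"
    and der: "\<And>t z. t \<in> T \<Longrightarrow> z \<in> S \<Longrightarrow> (K t has_field_derivative K' t z) (at z within S)"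
    and nz: "\<And>t z. t \<in> T \<Longrightarrow> z \<in> S \<Longrightarrow> K' t z \<noteq> 0"
  shows "compact {t \<in> T. \<not> inj_on (K t) S}"
  unfolding compact_def
proof (intro allI impI)
  fix t :: "nat \<Rightarrow> 'a"
  assume "\<forall>n. t n \<in> {t \<in> T. \<not> inj_on (K t) S}"
  then have tT: "\<And>n. t n \<in> T" and "\<forall>n. \<exists>a b. a \<in> S \<and> b \<in> S \<and> K (t n) a = K (t n) b \<and> a \<noteq> b"
    by (auto simp: inj_on_def) blast
  then obtain a b where ab: "\<And>n. a n \<in> S" "\<And>n. b n \<in> S" "\<And>n. K (t n) (a n) = K (t n) (b n)"
      "\<And>n. a n \<noteq> b n"
    by metis
  have "seq_compact (T \<times> (S \<times> S))"
    by (intro compact_imp_seq_compact compact_Times T S)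
  moreover have "\<forall>n. (t n, a n, b n) \<in> T \<times> (S \<times> S)"
    using tT ab by auto
  ultimately obtain l r where l: "l \<in> T \<times> (S \<times> S)" and r: "strict_mono r"
      and lim: "((\<lambda>n. (t n, a n, b n)) \<circ> r) \<longlonglongrightarrow> l"
    by (rule seq_compactE)
  obtain t0 a0 b0 where l_eq: "l = (t0, a0, b0)"
    by (metis prod_cases3)
  have in0: "t0 \<in> T" "a0 \<in> S" "b0 \<in> S"
    using l l_eq by auto
  have limt: "(\<lambda>n. t (r n)) \<longlonglongrightarrow> t0" and lima: "(\<lambda>n. a (r n)) \<longlonglongrightarrow> a0"
      and limb: "(\<lambda>n. b (r n)) \<longlonglongrightarrow> b0"
    using tendsto_fst[OF lim] tendsto_fst[OF tendsto_snd[OF lim]] tendsto_snd[OF tendsto_snd[OF lim]]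
    by (simp_all add: l_eq o_def)
  have Klim: "(\<lambda>n. K (t (r n)) (c n)) \<longlonglongrightarrow> K t0 c0"
    if "c \<longlonglongrightarrow> c0" "\<And>n. c n \<in> S" "c0 \<in> S" for c c0
    using continuous_on_tendsto_compose[OF contK tendsto_Pair[OF limt that(1)]] that tT in0 by simp
  have K0: "K t0 a0 = K t0 b0"
    using LIMSEQ_unique[OF Klim[OF lima] Klim[OF limb, folded ab(3)]] ab in0 by simp
  have "a0 \<noteq> b0"
  proof
    assume "a0 = b0"
    define D where "D = K' t0 a0"
    have "D \<noteq> 0"
      using nz in0 by (simp add: D_def)
    then obtain d where "d > 0" and
        d: "\<And>x. x \<in> T \<times> S \<Longrightarrow> dist x (t0, a0) < d \<Longrightarrow> dist (case x of (t, z) \<Rightarrow> K' t z) D < norm D / 2"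
      using contK' in0 unfolding continuous_on_iff D_def
      by (metis (no_types, lifting) SigmaI case_prod_conv half_gt_zero zero_less_norm_iff)
    have "\<forall>\<^sub>F n in sequentially. dist (t (r n)) t0 < d / 2 \<and> dist (a (r n)) a0 < d / 2 \<and> dist (b (r n)) a0 < d / 2"
      using limt lima limb \<open>d > 0\<close> \<open>a0 = b0\<close> by (intro eventually_conj tendstoD) auto
    then obtain n where n: "dist (t (r n)) t0 < d / 2" "dist (a (r n)) a0 < d / 2" "dist (b (r n)) a0 < d / 2"
      by (auto simp: eventually_sequentially)
    define s where "s = t (r n)"
    have s: "s \<in> T" "K s (a (r n)) = K s (b (r n))"
      using tT ab by (auto simp: s_def)
    \<comment> \<open>Near a0, K s differs from multiplication by D by a map with Lipschitz constant norm D / 2.\<close>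
    have "norm ((K s (a (r n)) - D * a (r n)) - (K s (b (r n)) - D * b (r n)))
            \<le> norm D / 2 * norm (a (r n) - b (r n))"
    proof (rule field_differentiable_bound[where S = "S \<inter> ball a0 (d / 2)" and f' = "\<lambda>z. K' s z - D"])
      show "convex (S \<inter> ball a0 (d / 2))"
        by (intro convex_Int S convex_ball)
    next
      fix z assume z: "z \<in> S \<inter> ball a0 (d / 2)"
      then have "(K s has_field_derivative K' s z) (at z within (S \<inter> ball a0 (d / 2)))"
        using der[OF s(1), of z] by (auto intro: DERIV_subset)
      then show "((\<lambda>z. K s z - D * z) has_field_derivative K' s z - D) (at z within (S \<inter> ball a0 (d / 2)))"
        by (auto intro!: derivative_eq_intros)
      have "dist (s, z) (t0, a0) \<le> dist s t0 + dist z a0"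
        by (simp add: dist_Pair_Pair sqrt_sum_squares_le_sum)
      also have "\<dots> < d"
        using n(1) z by (simp add: s_def dist_commute)
      finally have "dist (K' s z) D < norm D / 2"
        using d[of "(s, z)"] z s by simp
      then show "norm (K' s z - D) \<le> norm D / 2"
        by (simp add: dist_norm)
    qed (use n ab in \<open>auto simp: dist_commute\<close>)
    then have "norm (D * (b (r n) - a (r n))) \<le> norm D / 2 * norm (a (r n) - b (r n))"
      using s(2) by (simp add: algebra_simps)
    then show False
      using \<open>D \<noteq> 0\<close> ab(4)[of "r n"] by (simp add: norm_mult norm_minus_commute)
  qed
  then have "t0 \<in> {t \<in> T. \<not> inj_on (K t) S}"
    using K0 in0 by (auto simp: inj_on_def)
  then show "\<exists>l\<in>{t \<in> T. \<not> inj_on (K t) S}. \<exists>r. strict_mono r \<and> (t \<circ> r) \<longlonglongrightarrow> l"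
    using r limt by (auto simp: o_def)
qed

text \<open>
  Implicit differentiation of \<open>k h z = k 0 a\<close> at \<open>h = 0\<close> gives \<open>z = a * (1 - h * p) + o(h)\<close>. When
  \<open>Re p > 0\<close> this root moves towards the interior of the disc, so the value \<open>k 0 a\<close> is
  still taken in the closed disc for small \<open>h > 0\<close>, even if \<open>a\<close> lies on the circle. Since differentiability is assumed only at
  \<open>(0, a)\<close>, the root is a Brouwer fixed point of the Newton map with frozen derivative
  \<open>B\<close>, which maps a ball of radius proportional to \<open>h\<close> around \<open>a * (1 - h * p)\<close> into itself.
\<close>

lemma root_moves_inward:
  fixes k :: "real \<Rightarrow> complex \<Rightarrow> complex"
  assumes der: "((\<lambda>(h, z). k h z) has_derivative (\<lambda>(s, v). of_real s * (B * a * p) + B * v)) (at (0, a))"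
    and cont: "\<forall>\<^sub>F h in at_right 0. continuous_on (cball 0 1) (k h)"
    and B: "B \<noteq> 0" and a: "norm a \<le> 1" and p: "Re p > 0" and e: "e > 0"
  shows "\<forall>\<^sub>F h in at_right 0. \<exists>z\<in>cball 0 1. dist z a < e \<and> k h z = k 0 a"
proof -
  \<comment> \<open>The ball around a * (1 - h * p) has radius h * \<eta>; since that centre has norm at most
    1 - h * Re p / 2, the ball stays in the closed unit disc.\<close>
  define \<eta> where "\<eta> = min 1 (Re p / 2)"
  have \<eta>: "\<eta> > 0" "\<eta> \<le> 1" "\<eta> \<le> Re p / 2"
    using p by (auto simp: \<eta>_def)
  define C where "C = norm p + 2"
  have C: "C > 0"
    by (simp add: C_def add_nonneg_pos)
  have \<epsilon>: "\<eta> * norm B / C > 0"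
    using \<eta> B C by simp
  obtain d where "d > 0" and
      d: "\<And>h z. norm (h, z - a) < d \<Longrightarrow>
            norm (k h z - k 0 a - (of_real h * (B * a * p) + B * (z - a))) \<le> \<eta> * norm B / C * norm (h, z - a)"
  proof -
    from der \<epsilon> obtain d where "d > 0" "\<forall>y. norm (y - (0, a)) < d \<longrightarrow>
          norm ((case y of (h, z) \<Rightarrow> k h z) - k 0 a - (case y - (0, a) of (s, v) \<Rightarrow> of_real s * (B * a * p) + B * v))
             \<le> \<eta> * norm B / C * norm (y - (0, a))"
      unfolding has_derivative_at_alt by fastforce
    then show ?thesis
      by (intro that[of d]) (auto dest!: spec[where x = "(_, _)"])
  qed
  define h0 where "h0 = Min {Re p / (norm p)\<^sup>2, 1 / Re p, d / C, e / C}"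
  have p0: "norm p > 0"
    using p by auto
  have "h0 > 0"
    using p p0 \<open>d > 0\<close> e C by (simp add: h0_def)
  then have "\<forall>\<^sub>F h in at_right 0. h \<in> {0<..<h0}"
    by (rule eventually_at_right_real)
  then show ?thesis
    using cont
  proof eventually_elim
    case (elim h)
    then have h: "h > 0" "h < Re p / (norm p)\<^sup>2" "h < 1 / Re p" "h < d / C" "h < e / C"
      by (auto simp: h0_def)
    have h': "h * (norm p)\<^sup>2 < Re p" "h * Re p < 1" "h * C < d" "h * C < e"
      using h p p0 C by (simp_all add: field_simps)
    define c where "c = a - of_real h * a * p"
    have contract: "norm (1 - of_real h * p) \<le> 1 - h * Re p / 2"
    proof (rule power2_le_imp_le)
      have "(norm (1 - of_real h * p))\<^sup>2 = 1 - 2 * h * Re p + h * (h * (norm p)\<^sup>2)"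
        unfolding cmod_power2 by (simp add: algebra_simps power2_eq_square)
      also have "\<dots> \<le> 1 - 2 * h * Re p + h * Re p"
        using h h' by simp
      also have "\<dots> \<le> (1 - h * Re p / 2)\<^sup>2"
        using h by (simp add: power2_eq_square algebra_simps)
      finally show "(norm (1 - of_real h * p))\<^sup>2 \<le> (1 - h * Re p / 2)\<^sup>2" .
      show "0 \<le> 1 - h * Re p / 2"
        using h' by simp
    qed
    have "norm c = norm a * norm (1 - of_real h * p)"
      unfolding c_def by (subst norm_mult [symmetric]) (simp add: algebra_simps)
    also have "\<dots> \<le> 1 * norm (1 - of_real h * p)"
      using a by (intro mult_right_mono) auto
    finally have "norm c \<le> 1 - h * Re p / 2"
      using contract by simp
    moreover have "h * \<eta> \<le> h * (Re p / 2)"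
      using \<eta> h by (intro mult_left_mono) auto
    ultimately have "norm c + h * \<eta> \<le> 1"
      by simp
    then have sub: "cball c (h * \<eta>) \<subseteq> cball 0 1"
      by (simp add: cball_subset_cball_iff)
    have close: "norm (z - a) \<le> h * (norm p + 1)" if "z \<in> cball c (h * \<eta>)" for z
    proof -
      have "norm (z - a) \<le> norm (z - c) + norm (c - a)"
        by (rule norm_diff_triangle_ineq[of z c c a, simplified]) 
      also have "norm (z - c) \<le> h * 1"
        using that mult_left_mono[OF \<eta>(2), of h] h
        by (simp add: dist_norm norm_minus_commute order.trans)
      also have "norm (c - a) = h * (norm a * norm p)"
        using h by (simp add: c_def norm_mult)
      also have "\<dots> \<le> h * (1 * norm p)"
        using a h by (intro mult_left_mono mult_right_mono) auto
      finally show ?thesis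
        by (simp add: algebra_simps)
    qed
    \<comment> \<open>The Newton map sends z to c minus the linearisation error divided by B.\<close>
    have "\<exists>z\<in>cball c (h * \<eta>). z - (k h z - k 0 a) / B = z"
    proof -
      have "continuous_on (cball c (h * \<eta>)) (\<lambda>z. z - (k h z - k 0 a) / B)"
        using continuous_on_subset[OF elim(2) sub] B by (intro continuous_intros) auto
      moreover have "z - (k h z - k 0 a) / B \<in> cball c (h * \<eta>)" if z: "z \<in> cball c (h * \<eta>)" for z
      proof -
        define err where "err = k h z - k 0 a - (of_real h * (B * a * p) + B * (z - a))"
        have "norm (h, z - a) \<le> norm h + norm (z - a)"
          by (rule norm_Pair_le)
        also have "\<dots> \<le> h * C"
          using close[OF z] h by (simp add: C_def algebra_simps)
        finally have hz: "norm (h, z - a) \<le> h * C" .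
        have "norm err \<le> \<eta> * norm B / C * norm (h, z - a)"
          unfolding err_def using hz h' by (intro d) auto
        also have "\<dots> \<le> \<eta> * norm B / C * (h * C)"
          using hz \<epsilon> by (intro mult_left_mono) auto
        also have "\<dots> = h * \<eta> * norm B"
          using C by simp
        finally have "norm (err / B) \<le> h * \<eta>"
          using B by (simp add: norm_divide field_simps)
        moreover have "c - (z - (k h z - k 0 a) / B) = err / B"
          using B by (simp add: err_def c_def field_simps)
        ultimately show ?thesis
          by (simp add: dist_norm)
      qed
      ultimately show ?thesis
        using brouwer_ball[OF mult_pos_pos[OF h(1) \<eta>(1)], of c "\<lambda>z. z - (k h z - k 0 a) / B"] by blast
    qed
    then obtain z where z: "z \<in> cball c (h * \<eta>)" "k h z = k 0 a"
      using B by auto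
    have "norm (z - a) < e"
    proof -
      have "h * (norm p + 1) < h * C"
        using h by (simp add: C_def)
      then show ?thesis
        using close[OF z(1)] h' by simp
    qed
    then show ?case
      using z sub by (auto simp: dist_norm)
  qed
qed

lemma Re_Cayley_pos:
  fixes x y :: complex
  assumes "norm x < norm y"
  shows "Re ((y - x) / (y + x)) > 0"
proof -
  have "y + x \<noteq> 0"
    using assms by (metis add_eq_0_iff2 less_irrefl norm_minus_cancel)
  have "Re ((y - x) / (y + x)) = ((norm y)\<^sup>2 - (norm x)\<^sup>2) / (norm (y + x))\<^sup>2"
    unfolding Re_divide cmod_power2 by (simp add: algebra_simps power2_eq_square)
  moreover have "(norm x)\<^sup>2 < (norm y)\<^sup>2"
    using assms by (simp add: power_strict_mono)
  ultimately show ?thesis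
    using \<open>y + x \<noteq> 0\<close> by simp
qed

lemma cofactor_cancel:
  fixes S Q c D :: complex
  assumes "S \<noteq> 0"
  shows "S / Q * c * (D / S / Q) = D * c / Q\<^sup>2"
  using assms by (simp add: power2_eq_square)

text \<open>
  The differential of \<open>(q, z) \<mapsto> f (q * z) + (1 / q - q) * z * f' (q * z)\<close> at \<open>(Q, c)\<close> in the direction
  \<open>(- s, v)\<close>, with \<open>y\<close> and \<open>w\<close> standing for the values of \<open>f'\<close> and \<open>f''\<close> at \<open>Q * c\<close>: the chain rule
  on the left, the coefficients of \<open>s\<close> and \<open>v\<close> collected on the right.
\<close>

lemma chain_differential_identity:
  fixes Q c s v y w :: complex
  assumes "Q \<noteq> 0"
  shows "y * (Q * v - s * c) +
         ((1 / Q - Q) * c * (w * (Q * v - s * c)) + ((1 / Q\<^sup>2 + 1) * s * c + (1 / Q - Q) * v) * y)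
       = s * ((y - (1 - Q\<^sup>2) * (Q * c * w)) * c / Q\<^sup>2) + (y + (1 - Q\<^sup>2) * (Q * c * w)) / Q * v"
proof -
  define P where "P = inverse Q"
  have "P * Q = 1"
    using assms by (simp add: P_def)
  then show ?thesis
    unfolding divide_inverse power_inverse[symmetric] P_def[symmetric] mult_1_left by algebra
qed

text \<open>
  With \<open>q = exp (- t)\<close>, the maps \<open>K q / q\<close> for \<open>K q z = q * f (q * z) + (1 - q\<^sup>2) * z * f' (q * z)\<close> form
  Becker's Loewner chain, which runs from \<open>f\<close> at \<open>q = 1\<close> outwards as \<open>q\<close> decreases; the factor \<open>q\<close>
  makes \<open>K\<close> extend continuously to \<open>q = 0\<close>, where it is the injective map \<open>z \<mapsto> f' 0 * z\<close>. The hypothesis gives \<open>norm X < norm (f' (q * z))\<close> for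
  \<open>X = (1 - q\<^sup>2) * q * z * f'' (q * z)\<close>. Hence the derivative \<open>f' (q * z) + X\<close> of \<open>K q\<close> has no zero, and
  when \<open>q\<close> decreases the roots of \<open>K q z / q = const\<close> move with velocity \<open>- z * p\<close>, where
  \<open>p = (f' - X) / (f' + X) / q\<close> has positive real part.

  Therefore no \<open>K q\<close> can fail to be injective: the set \<open>N\<close> of bad parameters is compact and misses \<open>0\<close>; at
  its least element two distinct points have a common image, both roots can be followed inwards to
  slightly smaller parameters, and these would be bad as well.
\<close>

lemma Becker_closed_disc:
  fixes f f' f'' :: "complex \<Rightarrow> complex"
  assumes R: "R > 1"
    and f': "\<And>z. z \<in> ball 0 R \<Longrightarrow> (f has_field_derivative f' z) (at z)"
    and f'': "\<And>z. z \<in> ball 0 R \<Longrightarrow> (f' has_field_derivative f'' z) (at z)"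
    and contf'': "continuous_on (ball 0 R) f''"
    and Becker: "\<And>z. norm z \<le> 1 \<Longrightarrow> (1 - (norm z)\<^sup>2) * norm (z * f'' z) < norm (f' z)"
  shows "inj_on f (cball 0 1)"
proof -
  define K where "K = (\<lambda>(q::real) z. of_real q * f (of_real q * z) + (1 - (of_real q)\<^sup>2) * z * f' (of_real q * z))"
  define X where "X = (\<lambda>(q::real) z. (1 - (of_real q)\<^sup>2) * (of_real q * z * f'' (of_real q * z)))"
  define K' where "K' = (\<lambda>(q::real) z. f' (of_real q * z) + X q z)"
  have qz: "norm (of_real q * z) \<le> 1" "of_real q * z \<in> ball 0 R" if "q \<in> {0..1}" "z \<in> cball 0 1" for q :: real and z :: complex
  proof -
    have "norm (of_real q * z) = q * norm z"
      using that by (simp add: norm_mult)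
    also have "\<dots> \<le> 1"
      using that by (intro mult_le_one) auto
    finally show "norm (of_real q * z) \<le> 1" "of_real q * z \<in> ball 0 R"
      using R by auto
  qed
  have X_less: "norm (X q z) < norm (f' (of_real q * z))" if q: "q \<in> {0..1}" and z: "z \<in> cball 0 1" for q z
  proof -
    have "q\<^sup>2 \<le> 1"
      using q by (simp add: power_le_one)
    then have "norm (1 - (of_real q)\<^sup>2 :: complex) = 1 - q\<^sup>2"
      using norm_of_real[of "1 - q\<^sup>2", where 'a = complex] by simp
    then have "norm (X q z) = (1 - q\<^sup>2) * norm (of_real q * z * f'' (of_real q * z))"
      by (simp add: X_def norm_mult)
    also have "\<dots> \<le> (1 - (norm (of_real q * z))\<^sup>2) * norm (of_real q * z * f'' (of_real q * z))"
    proof (intro mult_right_mono diff_left_mono power_mono norm_ge_zero)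
      show "norm (of_real q * z) \<le> q"
        using z q by (simp add: norm_mult mult_left_le)
    qed
    also have "\<dots> < norm (f' (of_real q * z))"
      using qz[OF q z] by (intro Becker)
    finally show ?thesis .
  qed
  have contf: "continuous_on (ball 0 R) f" and contf': "continuous_on (ball 0 R) f'"
    using f' f'' by (meson DERIV_continuous_on has_field_derivative_at_within)+
  have joint: "continuous_on ({0..1} \<times> cball 0 1) (\<lambda>x. g (of_real (fst x) * snd x))"
    if "continuous_on (ball 0 R) g" for g :: "complex \<Rightarrow> complex"
    by (rule continuous_on_compose2[OF that]) (use qz in \<open>auto intro!: continuous_intros\<close>)
  have contK: "continuous_on ({0..1} \<times> cball 0 1) (\<lambda>(q, z). K q z)"
    unfolding K_def case_prod_beta by (intro continuous_intros joint contf contf')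
  have contK': "continuous_on ({0..1} \<times> cball 0 1) (\<lambda>(q, z). K' q z)"
    unfolding K'_def X_def case_prod_beta by (intro continuous_intros joint contf' contf'')
  have derK: "(K q has_field_derivative K' q z) (at z within cball 0 1)"
    if "q \<in> {0..1}" "z \<in> cball 0 1" for q z
  proof -
    have d: "((\<lambda>z. f (of_real q * z)) has_field_derivative f' (of_real q * z) * of_real q) (at z)"
         "((\<lambda>z. f' (of_real q * z)) has_field_derivative f'' (of_real q * z) * of_real q) (at z)"
      by (intro DERIV_chain2[OF f'] DERIV_chain2[OF f''] qz that DERIV_cmult_Id)+
    have "(K q has_field_derivative K' q z) (at z)"
      unfolding K_def K'_def X_def
      by (rule DERIV_cong[OF DERIV_add[OF DERIV_cmult[OF d(1)] DERIV_mult[OF DERIV_cmult_Id d(2)]]])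
        (simp add: algebra_simps power2_eq_square)
    then show ?thesis
      by (rule has_field_derivative_at_within)
  qed
  have K'_nz: "K' q z \<noteq> 0" if "q \<in> {0..1}" "z \<in> cball 0 1" for q z
    using X_less[OF that] unfolding K'_def by (metis add_eq_0_iff2 less_irrefl norm_minus_cancel)
  define N where "N = {q \<in> {0..1}. \<not> inj_on (K q) (cball 0 1)}"
  have "compact N"
    unfolding N_def
    by (rule compact_noninjective_parameters[OF _ _ _ contK contK' derK K'_nz]) auto
  have "N = {}"
  proof (rule ccontr)
    assume "N \<noteq> {}"
    obtain q where q: "q \<in> N" and least: "\<And>s. s \<in> N \<Longrightarrow> q \<le> s"
      using compact_attains_inf[OF \<open>compact N\<close> \<open>N \<noteq> {}\<close>] by blast
    have q01: "q \<in> {0..1}"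
      using q by (simp add: N_def)
    have "f' 0 \<noteq> 0"
      using Becker[of 0] by auto
    then have "inj_on (K 0) (cball 0 1)"
      by (simp add: K_def inj_on_def)
    then have "q > 0"
      using q by (cases "q = 0") (auto simp: N_def)
    obtain a b where ab: "a \<in> cball 0 1" "b \<in> cball 0 1" "K q a = K q b" "a \<noteq> b"
      using q by (auto simp: N_def inj_on_def)
    \<comment> \<open>The chain K / q itself, since roots are followed at a constant value; h measures the decrease of q.\<close>
    define k where "k = (\<lambda>h z. f (of_real (q - h) * z) +
                (1 / of_real (q - h) - of_real (q - h)) * z * f' (of_real (q - h) * z))"
    have k_K: "k h z = K (q - h) z / of_real (q - h)" if "h < q" for h z
    proof -
      define Q where "Q = complex_of_real (q - h)"
      have "Q \<noteq> 0"
        using that by (simp add: Q_def)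
      then show ?thesis
        unfolding k_def K_def Q_def[symmetric] by (simp add: field_simps power2_eq_square)
    qed
    have move: "\<forall>\<^sub>F h in at_right 0. \<exists>z\<in>cball 0 1. dist z c < dist a b / 2 \<and> k h z = k 0 c"
      if c: "c \<in> cball 0 1" for c
    proof -
      define u where "u = of_real q * c"
      define B where "B = K' q c / of_real q"
      define p where "p = (f' u - X q c) / (f' u + X q c) / of_real q"
      have B: "B \<noteq> 0"
        using K'_nz[OF q01 c] \<open>q > 0\<close> by (simp add: B_def)
      have Bcp: "B * c * p = (f' u - X q c) * c / (of_real q)\<^sup>2"
        using cofactor_cancel[OF K'_nz[OF q01 c]] by (simp add: B_def p_def K'_def u_def)
      have u: "u \<in> ball 0 R"
        unfolding u_def by (intro qz q01 c)
      have dfst: "((\<lambda>x. of_real (q - fst x) :: complex) has_derivative (\<lambda>x. - of_real (fst x))) (at (0, c))"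
      proof -
        have "((\<lambda>x. q - fst x) has_derivative (\<lambda>x. - fst x)) (at (0, c))"
          using has_derivative_diff[OF has_derivative_const has_derivative_fst[OF has_derivative_ident]]
          by fastforce
        from has_derivative_of_real[OF this] show ?thesis
          by simp
      qed
      have dsnd: "(snd has_derivative snd) (at (0 :: real, c))"
        by (intro has_derivative_snd has_derivative_ident)
      have dm: "((\<lambda>x. of_real (q - fst x) * snd x) has_derivative
          (\<lambda>x. of_real q * snd x - of_real (fst x) * c)) (at (0, c))"
        by (rule has_derivative_eq_rhs[OF has_derivative_mult[OF dfst dsnd]]) simp
      have df: "((\<lambda>x. f (of_real (q - fst x) * snd x)) has_derivative
            (\<lambda>x. f' u * (of_real q * snd x - of_real (fst x) * c))) (at (0, c))"
        by (rule has_derivative_compose[OF dm])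
          (use f'[OF u] in \<open>simp add: has_field_derivative_def u_def\<close>)
      have df': "((\<lambda>x. f' (of_real (q - fst x) * snd x)) has_derivative
            (\<lambda>x. f'' u * (of_real q * snd x - of_real (fst x) * c))) (at (0, c))"
        by (rule has_derivative_compose[OF dm])
          (use f''[OF u] in \<open>simp add: has_field_derivative_def u_def\<close>)
      have "((\<lambda>x. 1 / of_real (q - fst x) :: complex) has_derivative
            (\<lambda>x. of_real (fst x) / (of_real q)\<^sup>2)) (at (0, c))"
        by (rule has_derivative_eq_rhs[OF has_derivative_divide[OF has_derivative_const dfst]])
          (use \<open>q > 0\<close> in \<open>auto simp: power2_eq_square field_simps\<close>)
      then have dr: "((\<lambda>x. (1 / of_real (q - fst x) - of_real (q - fst x)) * snd x) has_derivative
            (\<lambda>x. (1 / (of_real q)\<^sup>2 + 1) * of_real (fst x) * c + (1 / of_real q - of_real q) * snd x)) (at (0, c))"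
        by (rule has_derivative_eq_rhs[OF has_derivative_mult[OF has_derivative_diff[OF _ dfst] dsnd]])
          (simp add: algebra_simps)
      have "((\<lambda>(h, z). k h z) has_derivative
            (\<lambda>x. f' u * (of_real q * snd x - of_real (fst x) * c) +
                ((1 / of_real q - of_real q) * c * (f'' u * (of_real q * snd x - of_real (fst x) * c)) +
                 ((1 / (of_real q)\<^sup>2 + 1) * of_real (fst x) * c + (1 / of_real q - of_real q) * snd x) * f' u)))
            (at (0, c))"
        unfolding k_def case_prod_beta
        by (rule has_derivative_eq_rhs[OF has_derivative_add[OF df has_derivative_mult[OF dr df']]])
          (simp add: u_def)
      also have "(\<lambda>x. f' u * (of_real q * snd x - of_real (fst x) * c) +
                ((1 / of_real q - of_real q) * c * (f'' u * (of_real q * snd x - of_real (fst x) * c)) +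
                 ((1 / (of_real q)\<^sup>2 + 1) * of_real (fst x) * c + (1 / of_real q - of_real q) * snd x) * f' u))
               = (\<lambda>(s, v). of_real s * (B * c * p) + B * v)"
        unfolding case_prod_beta Bcp unfolding B_def K'_def X_def u_def
        by (rule ext, rule chain_differential_identity) (use \<open>q > 0\<close> in simp)
      finally have "((\<lambda>(h, z). k h z) has_derivative (\<lambda>(s, v). of_real s * (B * c * p) + B * v)) (at (0, c))" .
      moreover have "\<forall>\<^sub>F h in at_right 0. continuous_on (cball 0 1) (k h)"
      proof -
        have "\<forall>\<^sub>F h in at_right 0. h \<in> {0<..<q}"
          using \<open>q > 0\<close> by (rule eventually_at_right_real)
        then show ?thesis
        proof eventually_elim
          case (elim h)
          then have "q - h \<in> {0..1}"
            using q01 by auto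
          then have "continuous_on (cball 0 1) (K (q - h))"
            by (rule DERIV_continuous_on[OF derK])
          then have "continuous_on (cball 0 1) (\<lambda>z. K (q - h) z / of_real (q - h))"
            using elim by (intro continuous_intros) auto
          moreover have "k h = (\<lambda>z. K (q - h) z / of_real (q - h))"
            using elim k_K by auto
          ultimately show ?case
            by simp
        qed
      qed
      moreover have "Re p > 0"
        using Re_Cayley_pos[OF X_less[OF q01 c]] \<open>q > 0\<close>
        unfolding p_def u_def Re_divide_of_real by (rule divide_pos_pos)
      ultimately show ?thesis
        using root_moves_inward[of k B c p "dist a b / 2"] c B ab by simp
    qed
    have "\<forall>\<^sub>F h in at_right 0. h \<in> {0<..<q}"
      using \<open>q > 0\<close> by (rule eventually_at_right_real)
    with move[OF ab(1)] move[OF ab(2)] have "\<forall>\<^sub>F h in at_right (0::real). False"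
    proof eventually_elim
      case (elim h)
      then obtain a' b' where a': "a' \<in> cball 0 1" "dist a' a < dist a b / 2" "k h a' = k 0 a"
          and b': "b' \<in> cball 0 1" "dist b' b < dist a b / 2" "k h b' = k 0 b"
        by blast
      have "a' \<noteq> b'"
        using dist_triangle_half_r[OF a'(2), of b] b'(2) by auto
      moreover have "k 0 a = k 0 b"
        using ab(3) \<open>q > 0\<close> by (simp add: k_K)
      then have "k h a' = k h b'"
        using a'(3) b'(3) by simp
      then have "K (q - h) a' = K (q - h) b'"
        using elim k_K[of h a'] k_K[of h b'] by (simp flip: of_real_diff)
      ultimately have "\<not> inj_on (K (q - h)) (cball 0 1)"
        using a'(1) b'(1) inj_onD by metis
      then have "q - h \<in> N"
        using elim(3) q01 unfolding N_def by simp
      then show False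
        using least[of "q - h"] elim(3) by simp
    qed
    then show False
      by simp
  qed
  then have "1 \<notin> N"
    by simp
  then have "inj_on (K 1) (cball 0 1)"
    by (simp add: N_def)
  then show ?thesis
    by (simp add: K_def)
qed

section \<open>Becker's univalence criterion\<close>

text \<open>
  The dilations \<open>f (r * z)\<close> with \<open>r < 1\<close> satisfy the strict inequality on the closed disc, because
  \<open>1 - (norm z)\<^sup>2\<close> is strictly smaller than \<open>1 - (norm (r * z))\<^sup>2\<close> for \<open>z \<noteq> 0\<close>, and two given points of the
  open disc lie in a disc of some radius \<open>r < 1\<close>.
\<close>

theorem Becker_criterion:
  assumes hol: "f holomorphic_on ball 0 1"
    and nz: "\<And>z. norm z < 1 \<Longrightarrow> deriv f z \<noteq> 0"
    and Becker: "\<And>z. norm z < 1 \<Longrightarrow> (1 - (norm z)\<^sup>2) * norm (z * deriv (deriv f) z) \<le> norm (deriv f z)"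
  shows "inj_on f (ball 0 1)"
proof (rule inj_onI)
  fix a b :: complex
  assume a: "a \<in> ball 0 1" and b: "b \<in> ball 0 1" and eq: "f a = f b"
  have "max (norm a) (norm b) < 1"
    using a b by simp
  then obtain r where r: "max (norm a) (norm b) < r" "r < 1"
    using dense by blast
  then have "r > 0"
    using norm_ge_zero[of a] by linarith
  have rz: "of_real r * z \<in> ball 0 1" if "z \<in> ball 0 (1 / r)" for z :: complex
    using that \<open>r > 0\<close> by (simp add: norm_mult field_simps)
  have hol': "deriv f holomorphic_on ball 0 1" "deriv (deriv f) holomorphic_on ball 0 1"
    using hol by (auto intro!: holomorphic_deriv)
  have "inj_on (\<lambda>z. f (of_real r * z)) (cball 0 1)"
  proof (rule Becker_closed_disc)
    show "1 < 1 / r"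
      using r(2) \<open>r > 0\<close> by simp
  next
    fix z :: complex assume z: "z \<in> ball 0 (1 / r)"
    show "((\<lambda>z. f (of_real r * z)) has_field_derivative of_real r * deriv f (of_real r * z)) (at z)"
      using DERIV_chain2[OF holomorphic_derivI[OF hol open_ball rz[OF z]] DERIV_cmult_Id]
      by (simp add: mult.commute)
    show "((\<lambda>z. of_real r * deriv f (of_real r * z)) has_field_derivative
             of_real r * (of_real r * deriv (deriv f) (of_real r * z))) (at z)"
      using DERIV_cmult[OF DERIV_chain2[OF holomorphic_derivI[OF hol'(1) open_ball rz[OF z]] DERIV_cmult_Id]]
      by (simp add: mult.commute)
  next
    show "continuous_on (ball 0 (1 / r)) (\<lambda>z. of_real r * (of_real r * deriv (deriv f) (of_real r * z)))"
      by (intro continuous_intros continuous_on_compose2[OF holomorphic_on_imp_continuous_on[OF hol'(2)]])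
        (use rz in auto)
  next
    fix z :: complex assume z: "norm z \<le> 1"
    define u where "u = of_real r * z"
    have norm_u: "norm u = r * norm z"
      using \<open>r > 0\<close> by (simp add: u_def norm_mult)
    also have "\<dots> \<le> r * 1"
      using z \<open>r > 0\<close> by (intro mult_left_mono) auto
    finally have u: "norm u < 1"
      using r by simp
    have "(1 - (norm z)\<^sup>2) * norm (u * deriv (deriv f) u) < norm (deriv f u)"
    proof (cases "u * deriv (deriv f) u = 0")
      case True
      then have norm_0: "norm (u * deriv (deriv f) u) = 0"
        by simp
      show ?thesis
        unfolding norm_0 using nz[OF u] by simp
    next
      case False
      then have "z \<noteq> 0"
        by (auto simp: u_def)
      then have "norm u < norm z"
        using r by (simp add: norm_u)
      then have "(norm u)\<^sup>2 < (norm z)\<^sup>2"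
        by (intro power_strict_mono) auto
      then have "(1 - (norm z)\<^sup>2) * norm (u * deriv (deriv f) u) < (1 - (norm u)\<^sup>2) * norm (u * deriv (deriv f) u)"
        using False by (intro mult_strict_right_mono) auto
      also have "\<dots> \<le> norm (deriv f u)"
        by (rule Becker[OF u])
      finally show ?thesis .
    qed
    then have "r * ((1 - (norm z)\<^sup>2) * norm (u * deriv (deriv f) u)) < r * norm (deriv f u)"
      using \<open>r > 0\<close> by (rule mult_strict_left_mono)
    then show "(1 - (norm z)\<^sup>2) * norm (z * (of_real r * (of_real r * deriv (deriv f) (of_real r * z))))
                 < norm (of_real r * deriv f (of_real r * z))"
      using \<open>r > 0\<close> by (simp add: u_def norm_mult algebra_simps)
  qed
  moreover have "a / of_real r \<in> cball 0 1" "b / of_real r \<in> cball 0 1"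
    using r \<open>r > 0\<close> by (auto simp: norm_divide)
  moreover have "of_real r * (a / of_real r) = a" "of_real r * (b / of_real r) = b"
    using \<open>r > 0\<close> by auto
  ultimately have "a / of_real r = b / of_real r"
    using eq by (metis (no_types, lifting) inj_onD)
  then show "a = b"
    using \<open>r > 0\<close> by simp
qed

section \<open>Consequences of the Schwarz lemma\<close>

text \<open>
  Apply the Schwarz lemma at \<open>0\<close> to \<open>w\<close> composed with the disc automorphisms that carry \<open>0\<close> to \<open>a\<close> and
  \<open>w a\<close> to \<open>0\<close>; their derivatives there are \<open>1 - (norm a)\<^sup>2\<close> and \<open>1 / (1 - (norm (w a))\<^sup>2)\<close>.
\<close>

lemma Schwarz_Pick_derivative:
  assumes hol: "w holomorphic_on ball 0 1" and w: "\<And>z. norm z < 1 \<Longrightarrow> norm (w z) < 1"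
    and a: "norm a < 1"
  shows "norm (deriv w a) * (1 - (norm a)\<^sup>2) / (1 - (norm (w a))\<^sup>2) \<le> 1"
proof -
  define b where "b = w a"
  have b: "norm b < 1"
    using w a by (simp add: b_def)
  define g where "g = (\<lambda>z. Moebius_function 0 b (w (Moebius_function 0 (- a) z)))"
  have M: "norm (Moebius_function 0 (- a) z) < 1" if "norm z < 1" for z
    using that a by (intro Moebius_function_norm_lt_1) auto
  have "(w \<circ> Moebius_function 0 (- a)) holomorphic_on ball 0 1"
    by (rule holomorphic_on_compose_gen[OF Moebius_function_holomorphic hol]) (use a M in auto)
  then have "(Moebius_function 0 b \<circ> (w \<circ> Moebius_function 0 (- a))) holomorphic_on ball 0 1"
    by (rule holomorphic_on_compose_gen[OF _ Moebius_function_holomorphic]) (use b M w in auto)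
  then have holg: "g holomorphic_on ball 0 1"
    by (simp add: g_def o_def)
  have "norm (deriv g 0) \<le> 1"
  proof (rule Schwarz_Lemma(2)[OF holg, where \<xi> = 0])
    show "g 0 = 0"
      by (simp add: g_def Moebius_function_of_zero b_def Moebius_function_eq_zero)
    show "norm (g z) < 1" if "norm z < 1" for z
      unfolding g_def by (intro Moebius_function_norm_lt_1 b w M that)
  qed simp
  have cnj: "1 - cnj x * x = of_real (1 - (norm x)\<^sup>2)" for x
    by (simp add: complex_norm_square mult.commute del: of_real_power)
  have pos: "1 - (norm x)\<^sup>2 > 0" if "norm x < 1" for x :: complex
    using that by (simp add: abs_square_less_1)
  have nz: "1 - cnj b * b \<noteq> 0"
    unfolding cnj using pos[OF b] by (simp del: of_real_diff)
  have d1: "(Moebius_function 0 (- a) has_field_derivative 1 - cnj a * a) (at 0)"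
    unfolding Moebius_function_def by (auto intro!: derivative_eq_intros)
  have d2: "(Moebius_function 0 b has_field_derivative 1 / (1 - cnj b * b)) (at b)"
    unfolding Moebius_function_def
    by (rule derivative_eq_intros refl | use nz in \<open>simp; fail\<close>)+
  have "Moebius_function 0 (- a) 0 = a"
    by (simp add: Moebius_function_of_zero)
  moreover have "(w has_field_derivative deriv w a) (at a)"
    using holomorphic_derivI[OF hol open_ball] a by simp
  ultimately have "((\<lambda>z. w (Moebius_function 0 (- a) z)) has_field_derivative deriv w a * (1 - cnj a * a)) (at 0)"
    by (intro DERIV_chain2[OF _ d1]) simp
  from DERIV_chain2[OF _ this, of "Moebius_function 0 b"]
  have "(g has_field_derivative 1 / (1 - cnj b * b) * (deriv w a * (1 - cnj a * a))) (at 0)"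
    unfolding g_def using d2 \<open>Moebius_function 0 (- a) 0 = a\<close> b_def by metis
  then have "deriv g 0 = 1 / (1 - cnj b * b) * (deriv w a * (1 - cnj a * a))"
    by (rule DERIV_imp_deriv)
  then have "norm (deriv g 0) = norm (deriv w a) * (1 - (norm a)\<^sup>2) / (1 - (norm b)\<^sup>2)"
    unfolding cnj using pos[OF a] pos[OF b]
    by (simp only: norm_mult norm_divide norm_of_real norm_one) simp
  then show ?thesis
    using \<open>norm (deriv g 0) \<le> 1\<close> by (simp add: b_def)
qed

text \<open>
  The Cayley transform \<open>(P - 1) / (P + 1)\<close> of a function with values in the right half-plane has values in
  the unit disc, and it vanishes at \<open>0\<close> because \<open>P 0 = 1\<close>. So the Schwarz lemma bounds it by \<open>norm z\<close>;
  solving for \<open>P - 1\<close> gives the estimate.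
\<close>

lemma Caratheodory_bound:
  assumes hol: "P holomorphic_on ball 0 1" and "P 0 = 1"
    and Re_pos: "\<And>z. norm z < 1 \<Longrightarrow> Re (P z) > 0" and z: "norm z < 1"
  shows "norm (P z - 1) \<le> 2 * norm z / (1 - norm z)"
proof -
  have less: "norm (P z - 1) < norm (P z + 1)" if "norm z < 1" for z
  proof (rule power2_less_imp_less)
    have "(norm (P z + 1))\<^sup>2 - (norm (P z - 1))\<^sup>2 = 4 * Re (P z)"
      unfolding cmod_power2 by (simp add: algebra_simps power2_eq_square)
    then show "(norm (P z - 1))\<^sup>2 < (norm (P z + 1))\<^sup>2"
      using Re_pos[OF that] by simp
  qed simp
  then have nz: "P z + 1 \<noteq> 0" if "norm z < 1" for z
    using that norm_ge_zero[of "P z - 1"] by (metis norm_zero not_less)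
  have "norm ((P z - 1) / (P z + 1)) \<le> norm z"
  proof (rule Schwarz_Lemma(1))
    show "(\<lambda>z. (P z - 1) / (P z + 1)) holomorphic_on ball 0 1"
      by (intro holomorphic_intros hol) (simp add: nz)
    show "norm ((P x - 1) / (P x + 1)) < 1" if "norm x < 1" for x
      using less[OF that] nz[OF that] by (simp add: norm_divide)
  qed (use assms in auto)
  then have "norm (P z - 1) \<le> norm z * norm (P z + 1)"
    using nz[OF z] by (simp add: norm_divide field_simps)
  also have "norm (P z + 1) \<le> norm (P z - 1) + 2"
    using norm_triangle_ineq[of "P z - 1" 2] by (simp add: add.commute)
  finally have "norm (P z - 1) \<le> norm z * (norm (P z - 1) + 2)"
    by (simp add: mult_left_mono)
  then have "norm (P z - 1) * (1 - norm z) \<le> 2 * norm z"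
    by (simp add: algebra_simps)
  then show ?thesis
    using z by (simp add: field_simps)
qed

lemma disc_sup_norm_upper:
  assumes w: "\<And>z. z \<in> \<D> \<Longrightarrow> norm (w z) < 1" and z: "z \<in> \<D>"
  shows "norm (w z) \<le> disc_sup_norm w"
  unfolding disc_sup_norm_def
  by (rule cSUP_upper[OF z]) (use w in \<open>auto intro!: bdd_aboveI[of _ 1] simp: less_imp_le\<close>)

lemma hyperbolic_norm_upper:
  assumes hol: "w holomorphic_on \<D>" and w: "\<And>z. z \<in> \<D> \<Longrightarrow> norm (w z) < 1" and z: "z \<in> \<D>"
  shows "norm (deriv w z) * (1 - (norm z)\<^sup>2) / (1 - (norm (w z))\<^sup>2) \<le> hyperbolic_norm w"
  unfolding hyperbolic_norm_def
proof (rule cSUP_upper[OF z])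
  show "bdd_above ((\<lambda>z. cmod (deriv w z) * (1 - (cmod z)\<^sup>2) / (1 - (cmod (w z))\<^sup>2)) ` \<D>)"
    using Schwarz_Pick_derivative[OF hol] w by (intro bdd_aboveI[of _ 1]) auto
qed

text \<open>
  Since \<open>k \<le> 1\<close>, the denominator is at least \<open>1 - norm (w z)\<close>. Writing
  \<open>1 / (1 - norm (w z)) = (1 + norm (w z)) / (1 - (norm (w z))\<^sup>2)\<close> makes the hyperbolic derivative of \<open>w\<close>
  appear.
\<close>

lemma dilatation_term_bound:
  assumes hol: "w holomorphic_on \<D>" and w: "\<And>z. z \<in> \<D> \<Longrightarrow> norm (w z) < 1" and z: "z \<in> \<D>"
    and k: "0 \<le> k" "k \<le> 1" and c: "norm c = 1"
  shows "(1 - (norm z)\<^sup>2) * norm (z * (of_real k * deriv w z / (1 + c * (of_real k * w z))))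
           \<le> k * hyperbolic_norm w * (1 + disc_sup_norm w)"
proof -
  define N where "N = (1 - (norm z)\<^sup>2) * norm (deriv w z)"
  have z1: "norm z < 1" and w1: "norm (w z) < 1"
    using z w by auto
  have N: "N \<ge> 0"
    using z1 by (simp add: N_def abs_square_le_1)
  have "norm (c * (of_real k * w z)) \<le> 1 * norm (w z)"
    using k c by (simp add: norm_mult mult_left_le_one_le)
  then have "1 - norm (w z) \<le> norm (1 + c * (of_real k * w z))"
    using norm_diff_ineq[of 1 "c * (of_real k * w z)"] by simp
  then have "norm (deriv w z) / norm (1 + c * (of_real k * w z)) \<le> norm (deriv w z) / (1 - norm (w z))"
    using w1 by (intro divide_left_mono mult_pos_pos) auto
  then have "norm z * (norm (deriv w z) / norm (1 + c * (of_real k * w z))) \<le> 1 * (norm (deriv w z) / (1 - norm (w z)))"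
    using z1 by (intro mult_mono) auto
  then have "(1 - (norm z)\<^sup>2) * k * (norm z * (norm (deriv w z) / norm (1 + c * (of_real k * w z))))
        \<le> (1 - (norm z)\<^sup>2) * k * (norm (deriv w z) / (1 - norm (w z)))"
    using z1 k by (intro mult_left_mono) (auto simp: abs_square_le_1)
  then have "(1 - (norm z)\<^sup>2) * norm (z * (of_real k * deriv w z / (1 + c * (of_real k * w z))))
        \<le> k * (N / (1 - norm (w z)))"
    using k by (simp add: N_def norm_mult norm_divide mult_ac)
  also have "N / (1 - norm (w z)) = N / (1 - (norm (w z))\<^sup>2) * (1 + norm (w z))"
  proof -
    have "1 - (norm (w z))\<^sup>2 = (1 + norm (w z)) * (1 - norm (w z))"
      by (simp add: algebra_simps power2_eq_square)
    moreover have "1 + norm (w z) \<noteq> 0"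
      using norm_ge_zero[of "w z"] by linarith
    ultimately show ?thesis
      by simp
  qed
  also have "k * (N / (1 - (norm (w z))\<^sup>2) * (1 + norm (w z))) \<le> k * (hyperbolic_norm w * (1 + disc_sup_norm w))"
  proof (intro mult_left_mono mult_mono add_left_mono k)
    show le: "N / (1 - (norm (w z))\<^sup>2) \<le> hyperbolic_norm w"
      using hyperbolic_norm_upper[of w, OF hol w z] by (simp add: N_def mult.commute)
    show "norm (w z) \<le> disc_sup_norm w"
      by (rule disc_sup_norm_upper[of w, OF w z])
    have "0 \<le> N / (1 - (norm (w z))\<^sup>2)"
      using N w1 by (intro divide_nonneg_nonneg) (auto simp: abs_square_le_1)
    then show "0 \<le> hyperbolic_norm w"
      using le by linarith
  qed (use norm_ge_zero[of "w z"] in linarith)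
  finally show ?thesis
    by (simp add: mult.assoc)
qed

section \<open>Logarithms in the disc and starlike functions\<close>

lemma disc_log:
  assumes hol: "f holomorphic_on \<D>" and nz: "\<And>z. z \<in> \<D> \<Longrightarrow> f z \<noteq> 0" and "f 0 = 1"
  shows holomorphic_disc_log: "disc_log f holomorphic_on \<D>"
    and disc_log_0: "disc_log f 0 = 0"
    and exp_disc_log: "\<And>z. z \<in> \<D> \<Longrightarrow> exp (disc_log f z) = f z"
proof -
  obtain L where L: "L holomorphic_on \<D>" "\<And>z. z \<in> \<D> \<Longrightarrow> exp (L z) = f z"
    using holomorphic_logarithm_exists[of \<D> f 0] hol nz by auto
  have "(\<lambda>z. L z - L 0) holomorphic_on \<D>"
    by (intro holomorphic_intros L)
  moreover have "exp (L z - L 0) = f z" if "z \<in> \<D>" for z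
    using L(2)[of 0] L(2)[OF that] \<open>f 0 = 1\<close> by (simp add: exp_diff)
  ultimately have "\<exists>L. L holomorphic_on \<D> \<and> L 0 = 0 \<and> (\<forall>z\<in>\<D>. exp (L z) = f z)"
    by (intro exI[of _ "\<lambda>z. L z - L 0"]) auto
  then have "disc_log f holomorphic_on \<D> \<and> disc_log f 0 = 0 \<and> (\<forall>z\<in>\<D>. exp (disc_log f z) = f z)"
    unfolding disc_log_def by (rule someI_ex)
  then show "disc_log f holomorphic_on \<D>" and "disc_log f 0 = 0" and "\<And>z. z \<in> \<D> \<Longrightarrow> exp (disc_log f z) = f z"
    by auto
qed

lemma deriv_disc_log:
  assumes hol: "f holomorphic_on \<D>" and nz: "\<And>z. z \<in> \<D> \<Longrightarrow> f z \<noteq> 0" and f0: "f 0 = 1"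
    and z: "z \<in> \<D>"
  shows "deriv (disc_log f) z = deriv f z / f z"
proof -
  have log: "disc_log f holomorphic_on \<D>" "\<And>z. z \<in> \<D> \<Longrightarrow> exp (disc_log f z) = f z"
    by (rule disc_log; use hol nz f0 in simp)+
  have "((\<lambda>z. exp (disc_log f z)) has_field_derivative f z * deriv (disc_log f) z) (at z)"
    using DERIV_chain2[OF DERIV_exp holomorphic_derivI[OF log(1) open_ball z]] log(2)[OF z] by auto
  then have "(f has_field_derivative f z * deriv (disc_log f) z) (at z)"
    by (rule has_field_derivative_transform_within_open[OF _ open_ball z]) (use log(2) in auto)
  then show ?thesis
    using nz[OF z] by (simp add: DERIV_imp_deriv)
qed

text \<open>
  The value at \<open>0\<close> fills in the removable singularity when \<open>\<phi> 0 = 0\<close>.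
\<close>

definition quotient_by_id :: "(complex \<Rightarrow> complex) \<Rightarrow> complex \<Rightarrow> complex"
  where "quotient_by_id \<phi> z = (if z = 0 then deriv \<phi> 0 else \<phi> z / z)"

lemma starlike_quotient:
  assumes \<phi>: "\<phi> \<in> starlike_class \<delta>" and \<delta>: "0 \<le> \<delta>"
  shows starlike_quotient_holomorphic: "quotient_by_id \<phi> holomorphic_on \<D>"
    and starlike_quotient_0: "quotient_by_id \<phi> 0 = 1"
    and starlike_quotient_nonzero: "\<And>z. z \<in> \<D> \<Longrightarrow> quotient_by_id \<phi> z \<noteq> 0"
proof -
  from \<phi> have hol: "\<phi> holomorphic_on \<D>" and "\<phi> 0 = 0" "deriv \<phi> 0 = 1"
      and Re: "\<And>z. z \<in> \<D> \<Longrightarrow> z \<noteq> 0 \<Longrightarrow> Re (z * deriv \<phi> z / \<phi> z) > \<delta>"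
    by (auto simp: starlike_class_def)
  show "quotient_by_id \<phi> holomorphic_on \<D>"
    by (rule pole_theorem_open_0[OF hol open_ball, of 0]) (auto simp: quotient_by_id_def \<open>\<phi> 0 = 0\<close>)
  show "quotient_by_id \<phi> 0 = 1"
    by (simp add: quotient_by_id_def \<open>deriv \<phi> 0 = 1\<close>)
  show "quotient_by_id \<phi> z \<noteq> 0" if "z \<in> \<D>" for z
    using Re[OF that] \<delta> \<open>deriv \<phi> 0 = 1\<close> by (auto simp: quotient_by_id_def)
qed

text \<open>
  For \<open>\<phi> = z * g\<close> the starlikeness quotient \<open>z * \<phi>' / \<phi>\<close> is \<open>1 + z * g' / g\<close>; it equals \<open>1\<close> at the
  origin and has positive real part, so Caratheodory's bound applies.
\<close>

lemma starlike_log_derivative_bound: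
  assumes \<phi>: "\<phi> \<in> starlike_class \<delta>" and \<delta>: "0 \<le> \<delta>" and z: "z \<in> \<D>"
  shows "norm (z * (deriv (quotient_by_id \<phi>) z / quotient_by_id \<phi> z)) \<le> 2 * norm z / (1 - norm z)"
proof -
  define g where "g = quotient_by_id \<phi>"
  note g = starlike_quotient[OF \<phi> \<delta>, folded g_def]
  from \<phi> have "\<phi> 0 = 0" and Re: "\<And>z. z \<in> \<D> \<Longrightarrow> z \<noteq> 0 \<Longrightarrow> Re (z * deriv \<phi> z / \<phi> z) > \<delta>"
    by (auto simp: starlike_class_def)
  have \<phi>_eq: "\<phi> z = z * g z" for z
    using \<open>\<phi> 0 = 0\<close> by (simp add: g_def quotient_by_id_def)
  define P where "P = (\<lambda>z. 1 + z * (deriv g z / g z))"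
  have "norm (P z - 1) \<le> 2 * norm z / (1 - norm z)"
  proof (rule Caratheodory_bound)
    show "P holomorphic_on ball 0 1"
      unfolding P_def by (intro holomorphic_intros g holomorphic_deriv) auto
    show "P 0 = 1"
      by (simp add: P_def)
    show "Re (P x) > 0" if x: "norm x < 1" for x
    proof (cases "x = 0")
      case False
      have "(g has_field_derivative deriv g x) (at x)"
        using x by (intro holomorphic_derivI[OF g(1) open_ball]) auto
      from DERIV_mult[OF DERIV_ident this] have "deriv \<phi> x = g x + x * deriv g x"
        by (intro DERIV_imp_deriv) (simp add: \<phi>_eq[abs_def] algebra_simps)
      then have "x * deriv \<phi> x / \<phi> x = P x"
        using False g(3)[of x] x by (simp add: P_def \<phi>_eq field_simps)
      then show ?thesis
        using Re[of x] False x \<delta> by simp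
    qed (simp add: P_def)
    show "norm z < 1"
      using z by simp
  qed
  then show ?thesis
    by (simp add: P_def g_def)
qed

section \<open>The transform and its pre-Schwarzian derivative\<close>

lemma C_base_regular:
  assumes \<phi>: "\<phi> \<in> starlike_class \<delta>" and \<delta>: "0 \<le> \<delta>"
  shows C_base_holomorphic: "C_base \<beta> \<phi> holomorphic_on \<D>"
    and C_base_nonzero: "\<And>z. z \<in> \<D> \<Longrightarrow> C_base \<beta> \<phi> z \<noteq> 0"
    and C_base_0: "C_base \<beta> \<phi> 0 = 1"
    and C_base_log_derivative: "\<And>z. z \<in> \<D> \<Longrightarrow> deriv (C_base \<beta> \<phi>) z / C_base \<beta> \<phi> z =
           deriv (quotient_by_id \<phi>) z / quotient_by_id \<phi> z + of_real \<beta> / (1 - z)"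
proof -
  define g where "g = quotient_by_id \<phi>"
  note g = starlike_quotient[OF \<phi> \<delta>, folded g_def]
  define M where "M = disc_log (\<lambda>u. 1 - u)"
  have nz: "1 - z \<noteq> 0" if "z \<in> \<D>" for z :: complex
    using that by auto
  have lin: "(\<lambda>u. 1 - u) holomorphic_on \<D>"
    by (intro holomorphic_intros)
  have M: "M holomorphic_on \<D>" "M 0 = 0" and dM: "\<And>z. z \<in> \<D> \<Longrightarrow> deriv M z = - 1 / (1 - z)"
  proof -
    show "M holomorphic_on \<D>" "M 0 = 0"
      unfolding M_def by (rule disc_log; use lin nz in simp)+
    show "deriv M z = - 1 / (1 - z)" if "z \<in> \<D>" for z
    proof -
      have "((\<lambda>u. 1 - u) has_field_derivative - 1) (at z)"
        by (auto intro!: derivative_eq_intros)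
      then have "deriv (\<lambda>u. 1 - u) z = - 1"
        by (rule DERIV_imp_deriv)
      then show ?thesis
        unfolding M_def using lin nz that by (subst deriv_disc_log) simp_all
    qed
  qed
  have C_eq: "C_base \<beta> \<phi> = (\<lambda>z. g z / exp (of_real \<beta> * M z))"
    by (simp add: fun_eq_iff C_base_def disc_power_def M_def g_def quotient_by_id_def)
  show "C_base \<beta> \<phi> holomorphic_on \<D>"
    unfolding C_eq by (intro holomorphic_intros g M) auto
  show "C_base \<beta> \<phi> z \<noteq> 0" if "z \<in> \<D>" for z
    using g(3)[OF that] by (simp add: C_eq)
  show "C_base \<beta> \<phi> 0 = 1"
    by (simp add: C_eq g M)
  show "deriv (C_base \<beta> \<phi>) z / C_base \<beta> \<phi> z = deriv (quotient_by_id \<phi>) z / quotient_by_id \<phi> z + of_real \<beta> / (1 - z)"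
    if z: "z \<in> \<D>" for z
  proof -
    define E where "E = exp (of_real \<beta> * M z)"
    have "((\<lambda>z. exp (of_real \<beta> * M z)) has_field_derivative E * (of_real \<beta> * deriv M z)) (at z)"
      unfolding E_def by (intro DERIV_chain2[OF DERIV_exp] DERIV_cmult holomorphic_derivI[OF M(1) open_ball z])
    from DERIV_divide[OF holomorphic_derivI[OF g(1) open_ball z] this]
    have dC: "deriv (C_base \<beta> \<phi>) z = (deriv g z * E - g z * (E * (of_real \<beta> * deriv M z))) / (E * E)"
      unfolding C_eq by (intro DERIV_imp_deriv) (simp add: E_def)
    have CE: "C_base \<beta> \<phi> z = g z / E" and "E \<noteq> 0"
      by (simp_all add: C_eq E_def)
    then have "deriv (C_base \<beta> \<phi>) z / C_base \<beta> \<phi> z = deriv g z / g z - of_real \<beta> * deriv M z"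
      unfolding dC CE using g(3)[OF z] by (simp add: field_simps)
    then show ?thesis
      using dM[OF z] by (simp add: g_def)
  qed
qed

text \<open>
  The numerator contributes at most \<open>2 * norm z / (1 - norm z)\<close> by starlikeness and the denominator
  at most \<open>\<beta> * norm z / (1 - norm z)\<close>; the factor \<open>1 - (norm z)\<^sup>2\<close> leaves \<open>(1 + norm z) * norm z \<le> 2\<close>.
\<close>

lemma C_base_log_derivative_bound:
  assumes \<phi>: "\<phi> \<in> starlike_class \<delta>" and \<delta>: "0 \<le> \<delta>" and \<beta>: "0 \<le> \<beta>" and z: "z \<in> \<D>"
  shows "(1 - (norm z)\<^sup>2) * norm (z * deriv (disc_log (C_base \<beta> \<phi>)) z) \<le> 2 * (2 + \<beta>)"
proof -
  define g where "g = deriv (quotient_by_id \<phi>) z / quotient_by_id \<phi> z"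
  have z1: "norm z < 1"
    using z by simp
  have "norm (z * deriv (disc_log (C_base \<beta> \<phi>)) z) = norm (z * g + of_real \<beta> * z / (1 - z))"
    using C_base_regular[OF \<phi> \<delta>] z by (subst deriv_disc_log) (simp_all add: g_def algebra_simps)
  also have "\<dots> \<le> norm (z * g) + norm (of_real \<beta> * z / (1 - z))"
    by (rule norm_triangle_ineq)
  also have "norm (of_real \<beta> * z / (1 - z)) = \<beta> * norm z / norm (1 - z)"
    using \<beta> by (simp add: norm_mult norm_divide)
  also have "\<dots> \<le> \<beta> * norm z / (1 - norm z)"
    using z1 \<beta> norm_triangle_ineq2[of 1 z] by (intro divide_left_mono mult_pos_pos mult_nonneg_nonneg) auto
  also have "norm (z * g) \<le> 2 * norm z / (1 - norm z)"
    unfolding g_def by (rule starlike_log_derivative_bound[OF \<phi> \<delta> z])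
  finally have "norm (z * deriv (disc_log (C_base \<beta> \<phi>)) z) \<le> (2 + \<beta>) * (norm z / (1 - norm z))"
    by (simp add: distrib_right add_divide_distrib)
  then have "(1 - (norm z)\<^sup>2) * norm (z * deriv (disc_log (C_base \<beta> \<phi>)) z)
        \<le> (1 - (norm z)\<^sup>2) * ((2 + \<beta>) * (norm z / (1 - norm z)))"
    using z1 by (intro mult_left_mono) (auto simp: abs_square_le_1)
  also have "\<dots> = (1 + norm z) * (1 - norm z) * ((2 + \<beta>) * (norm z / (1 - norm z)))"
    by (simp add: algebra_simps power2_eq_square)
  also have "\<dots> = (2 + \<beta>) * ((1 + norm z) * norm z)"
    using z1 by simp
  also have "\<dots> \<le> (2 + \<beta>) * (2 * 1)"
    using z1 \<beta> by (intro mult_left_mono mult_mono) auto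
  finally show ?thesis
    by simp
qed

lemma C_transform_has_derivative:
  assumes \<phi>: "\<phi> \<in> starlike_class \<delta>" and \<delta>: "0 \<le> \<delta>" and z: "z \<in> \<D>"
  shows "(C_transform \<alpha> \<beta> \<phi> has_field_derivative disc_power (C_base \<beta> \<phi>) \<alpha> z) (at z)"
proof -
  define p where "p = disc_power (C_base \<beta> \<phi>) \<alpha>"
  have "p holomorphic_on \<D>"
    unfolding p_def disc_power_def
    by (intro holomorphic_intros holomorphic_disc_log C_base_regular[OF \<phi> \<delta>])
  then obtain I where I: "\<And>x. x \<in> \<D> \<Longrightarrow> (I has_field_derivative p x) (at x within \<D>)"
    using holomorphic_convex_primitive'[OF convex_ball open_ball] by blast
  have eq: "C_transform \<alpha> \<beta> \<phi> x = I x - I 0" if x: "x \<in> \<D>" for x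
  proof -
    have "closed_segment 0 x \<subseteq> \<D>"
      using x by (intro closed_segment_subset) auto
    then have "(p has_contour_integral I (pathfinish (linepath 0 x)) - I (pathstart (linepath 0 x))) (linepath 0 x)"
      by (intro contour_integral_primitive[where S = \<D>])
        (simp_all only: I valid_path_linepath path_image_linepath)
    then have "(p has_contour_integral I x - I 0) (linepath 0 x)"
      by simp
    then show ?thesis
      unfolding C_transform_def p_def[symmetric] by (rule contour_integral_unique)
  qed
  have "(I has_field_derivative p z) (at z)"
    using I[OF z] by (simp add: at_within_open[OF z open_ball])
  from DERIV_diff[OF this DERIV_const[of "I 0"]]
  have "((\<lambda>x. I x - I 0) has_field_derivative p z) (at z)"
    by simp
  then show ?thesis
    unfolding p_def[symmetric]
    by (rule has_field_derivative_transform_within_open[OF _ open_ball z]) (simp add: eq)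
qed

lemma C_transform_rot_has_derivative:
  assumes \<phi>: "\<phi> \<in> starlike_class \<delta>" and \<delta>: "0 \<le> \<delta>" and z: "z \<in> \<D>"
  shows "(C_transform_rot \<theta> \<alpha> \<beta> \<phi> has_field_derivative
            exp (of_real \<alpha> * disc_log (C_base \<beta> \<phi>) (exp (\<i> * of_real \<theta>) * z))) (at z)"
proof -
  define e where "e = exp (\<i> * of_real \<theta>)"
  have "e * z \<in> \<D>"
    using z by (simp add: e_def norm_mult)
  from DERIV_cmult[OF DERIV_chain2[OF C_transform_has_derivative[OF \<phi> \<delta> this] DERIV_cmult_Id], of "inverse e"]
  have "((\<lambda>z. inverse e * C_transform \<alpha> \<beta> \<phi> (e * z)) has_field_derivative
           inverse e * (disc_power (C_base \<beta> \<phi>) \<alpha> (e * z) * e)) (at z)" .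
  moreover have "inverse e * (disc_power (C_base \<beta> \<phi>) \<alpha> (e * z) * e)
      = exp (of_real \<alpha> * disc_log (C_base \<beta> \<phi>) (e * z))"
    by (simp add: e_def disc_power_def)
  moreover have "C_transform_rot \<theta> \<alpha> \<beta> \<phi> = (\<lambda>z. inverse e * C_transform \<alpha> \<beta> \<phi> (e * z))"
    by (simp add: fun_eq_iff C_transform_rot_def e_def exp_minus)
  ultimately show ?thesis
    by (simp add: e_def)
qed

section \<open>Stable univalence of the shear\<close>

text \<open>
  If \<open>h + \<mu> * cnj g\<close> identifies two points, the increments of \<open>h\<close> and \<open>g\<close> between them have the same
  modulus, so some analytic combination \<open>h + c * g\<close> with \<open>norm c = 1\<close> identifies them too.
\<close>

lemma stable_injectivity:
  fixes h g :: "'a \<Rightarrow> complex"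
  assumes inj: "\<And>c. norm c = 1 \<Longrightarrow> inj_on (\<lambda>z. h z + c * g z) S" and "norm \<mu> = 1"
  shows "inj_on (\<lambda>z. h z + \<mu> * cnj (g z)) S"
proof (rule inj_onI)
  fix x y
  assume xy: "x \<in> S" "y \<in> S" and eq: "h x + \<mu> * cnj (g x) = h y + \<mu> * cnj (g y)"
  define A where "A = h x - h y"
  define B where "B = g x - g y"
  have A: "A = - (\<mu> * cnj B)"
    using eq by (simp add: A_def B_def algebra_simps)
  \<comment> \<open>If B = 0 then A = 0 as well, and any unimodular c serves.\<close>
  define c where "c = (if B = 0 then 1 else - A / B)"
  have "norm c = 1"
    using \<open>norm \<mu> = 1\<close> by (simp add: c_def A norm_mult norm_divide)
  moreover have "A + c * B = 0"
    by (simp add: c_def A)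
  then have "h x + c * g x = h y + c * g y"
    by (simp add: A_def B_def algebra_simps)
  ultimately show "x = y"
    using inj xy by (auto dest: inj_onD)
qed

theorem theorem4p1:
  fixes \<delta> \<theta> \<alpha> \<beta> :: real
    and \<phi> w F H G :: "complex \<Rightarrow> complex"
  assumes "0 \<le> \<delta>" and "\<delta> < 1"
    and "\<phi> \<in> starlike_class \<delta>"
    and "0 \<le> \<theta>" and "\<theta> < pi"
    and "0 \<le> \<alpha>" and "0 \<le> \<beta>"
    and "w holomorphic_on \<D>" and "\<forall>z\<in>\<D>. cmod (w z) < 1"
    and "horizontal_shear (C_transform_rot \<theta> \<alpha> \<beta> \<phi>)
           (\<lambda>z. of_real (\<alpha> * (1 + \<beta>)) * w z) F H G"
    and "sense_preserving H G"
    and "\<alpha> \<le> 1 / (2 * (2 + \<beta> + (1 + \<beta>) * hyperbolic_norm w * (1 + disc_sup_norm w)))"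
  shows "F \<in> SHU"
proof -
  note \<delta> = assms(1) and \<phi> = assms(3) and \<alpha> = assms(6) and \<beta> = assms(7) and holw = assms(8)
  have w: "\<And>z. z \<in> \<D> \<Longrightarrow> norm (w z) < 1"
    using assms(9) by blast
  define k where "k = \<alpha> * (1 + \<beta>)"
  define X where "X = hyperbolic_norm w * (1 + disc_sup_norm w)"
  have decomp: "harmonic_decomp F H G" and HG: "\<And>z. z \<in> \<D> \<Longrightarrow> H z - G z = C_transform_rot \<theta> \<alpha> \<beta> \<phi> z"
    and dG: "\<And>z. z \<in> \<D> \<Longrightarrow> deriv G z = of_real k * w z * deriv H z"
    using assms(10) by (auto simp: horizontal_shear_def k_def)
  have hol: "H holomorphic_on \<D>" "G holomorphic_on \<D>"
    using decomp by (auto simp: harmonic_decomp_def)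
  have "X \<ge> 0"
  proof -
    have "0 \<le> disc_sup_norm w"
      using disc_sup_norm_upper[of w 0, OF w] norm_ge_zero[of "w 0"] by (simp del: norm_ge_zero)
    moreover have "0 \<le> norm (deriv w 0) * (1 - (norm (0::complex))\<^sup>2) / (1 - (norm (w 0))\<^sup>2)"
      using w[of 0] by (simp add: abs_square_le_1)
    then have "0 \<le> hyperbolic_norm w"
      using hyperbolic_norm_upper[of w 0, OF holw w] by simp
    ultimately show ?thesis
      by (simp add: X_def)
  qed
  have "2 + \<beta> + (1 + \<beta>) * X > 0"
    using \<beta> \<open>X \<ge> 0\<close> by (intro add_pos_nonneg) auto
  \<comment> \<open>The hypothesis on \<alpha>, cleared of its denominator: the first summand will bound the
    contribution of the transform, and k * X that of each of the two dilatation factors.\<close>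
  then have budget: "\<alpha> * (2 * (2 + \<beta>)) + 2 * (k * X) \<le> 1"
    using assms(12) by (simp add: X_def k_def field_simps)
  have k: "0 \<le> k" "k \<le> 1"
  proof -
    show "0 \<le> k"
      using \<alpha> \<beta> by (simp add: k_def)
    then have "0 \<le> k * X"
      using \<open>X \<ge> 0\<close> by simp
    moreover have "k \<le> \<alpha> * (2 * (2 + \<beta>))"
      unfolding k_def using \<alpha> \<beta> by (intro mult_left_mono) auto
    ultimately show "k \<le> 1"
      using budget by linarith
  qed
  define e where "e = exp (\<i> * of_real \<theta>)"
  define L where "L = disc_log (C_base \<beta> \<phi>)"
  have holL: "L holomorphic_on \<D>"
    unfolding L_def by (intro holomorphic_disc_log C_base_regular[OF \<phi> \<delta>])
  have "norm e = 1"
    by (simp add: e_def)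
  then have ez: "e * z \<in> \<D>" if "z \<in> \<D>" for z
    using that by (simp add: norm_mult)
  have nz: "1 + c * (of_real k * w z) \<noteq> 0" if "z \<in> \<D>" "norm c = 1" for c z
  proof
    assume "1 + c * (of_real k * w z) = 0"
    then have "c * (of_real k * w z) = - 1"
      by (simp add: add_eq_0_iff)
    then have "k * norm (w z) = 1"
      using that k by (metis abs_of_nonneg mult_1 norm_minus_cancel norm_mult norm_of_real norm_one)
    moreover have "k * norm (w z) \<le> 1 * norm (w z)"
      using k by (intro mult_right_mono) auto
    ultimately show False
      using w[OF that(1)] by simp
  qed
  have inj: "inj_on (\<lambda>z. H z + c * G z) \<D>" if c: "norm c = 1" for c
  proof -
    define f where "f = (\<lambda>z. H z + c * G z)"
    define E where "E = (\<lambda>z. exp (of_real \<alpha> * L (e * z)))"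
    define n where "n = (\<lambda>z. 1 + c * (of_real k * w z))"
    \<comment> \<open>Written like n, with c replaced by -1, so that one estimate covers both factors.\<close>
    define m where "m = (\<lambda>z. 1 + (- 1) * (of_real k * w z))"
    have nm: "n z \<noteq> 0" "m z \<noteq> 0" if "z \<in> \<D>" for z
      using nz[OF that c] nz[OF that, of "- 1"] by (simp_all add: n_def m_def)
    have df: "deriv f z = E z * (n z / m z)" if z: "z \<in> \<D>" for z
    proof -
      note dH' = holomorphic_derivI[OF hol(1) open_ball z] and dG' = holomorphic_derivI[OF hol(2) open_ball z]
      have "((\<lambda>z. H z - G z) has_field_derivative E z) (at z)"
        using C_transform_rot_has_derivative[OF \<phi> \<delta> z, of \<theta> \<alpha> \<beta>] HG
        by (auto simp: E_def L_def e_def intro: has_field_derivative_transform_within_open[OF _ open_ball z])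
      then have "deriv H z - deriv G z = E z"
        using DERIV_unique DERIV_diff[OF dH' dG'] by blast
      then have "deriv H z * m z = E z"
        by (simp add: dG[OF z] m_def algebra_simps)
      then have "deriv H z = E z / m z"
        using nm(2)[OF z] by (simp add: field_simps)
      moreover have "deriv f z = deriv H z * n z"
        using DERIV_imp_deriv[OF DERIV_add[OF dH' DERIV_cmult[OF dG', of c]]]
        by (simp add: f_def dG[OF z] n_def algebra_simps)
      ultimately show ?thesis
        by simp
    qed
    have "inj_on f \<D>"
    proof (rule Becker_criterion)
      show "f holomorphic_on \<D>"
        unfolding f_def by (intro holomorphic_intros hol)
    next
      fix z :: complex assume "norm z < 1"
      then have z: "z \<in> \<D>"
        by simp
      show "deriv f z \<noteq> 0"
        using nm[OF z] by (simp add: df[OF z] E_def)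
      \<comment> \<open>The logarithmic derivatives of the factors of f' = E * n / m, up to the factor c of a2.\<close>
      define a1 where "a1 = of_real \<alpha> * (e * deriv L (e * z))"
      define a2 where "a2 = of_real k * deriv w z / n z"
      define a3 where "a3 = of_real k * deriv w z / m z"
      have dw: "(w has_field_derivative deriv w z) (at z)"
        by (rule holomorphic_derivI[OF holw open_ball z])
      have dE: "(E has_field_derivative E z * a1) (at z)"
        unfolding E_def a1_def
        by (rule DERIV_cong[OF DERIV_chain2[OF DERIV_exp DERIV_cmult[OF
                DERIV_chain2[OF holomorphic_derivI[OF holL open_ball ez[OF z]] DERIV_cmult_Id]]]])
          (simp add: mult_ac)
      have dlin: "((\<lambda>z. 1 + d * (of_real k * w z)) has_field_derivative d * (of_real k * deriv w z)) (at z)" for d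
        by (rule DERIV_cong[OF DERIV_add[OF DERIV_const DERIV_cmult[OF DERIV_cmult[OF dw]]]]) simp
      have dn: "(n has_field_derivative c * (of_real k * deriv w z)) (at z)"
        unfolding n_def by (rule dlin)
      have dm: "(m has_field_derivative - 1 * (of_real k * deriv w z)) (at z)"
        unfolding m_def by (rule dlin)
      have "((\<lambda>z. E z * (n z / m z)) has_field_derivative E z * (n z / m z) * (a1 + c * a2 + a3)) (at z)"
        by (rule DERIV_cong[OF DERIV_mult[OF dE DERIV_divide[OF dn dm nm(2)[OF z]]]])
          (use nm[OF z] in \<open>simp add: a2_def a3_def field_simps\<close>)
      then have "(deriv f has_field_derivative deriv f z * (a1 + c * a2 + a3)) (at z)"
        unfolding df[OF z]
        by (rule has_field_derivative_transform_within_open[OF _ open_ball z]) (simp add: df)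
      then have ddf: "deriv (deriv f) z = deriv f z * (a1 + c * a2 + a3)"
        by (rule DERIV_imp_deriv)
      define r where "r = 1 - (norm z)\<^sup>2"
      have r: "r \<ge> 0"
        using z by (simp add: r_def abs_square_le_1)
      have "r * norm (z * (a1 + c * a2 + a3)) \<le> r * (norm (z * a1) + norm (z * a2) + norm (z * a3))"
      proof (rule mult_left_mono[OF _ r])
        have "norm (z * (a1 + c * a2 + a3)) \<le> norm (z * a1) + norm (z * (c * a2)) + norm (z * a3)"
          unfolding distrib_left
          by (rule order.trans[OF norm_triangle_ineq add_right_mono[OF norm_triangle_ineq]])
        then show "norm (z * (a1 + c * a2 + a3)) \<le> norm (z * a1) + norm (z * a2) + norm (z * a3)"
          using c by (simp add: norm_mult)
      qed
      also have "\<dots> = r * norm (z * a1) + r * norm (z * a2) + r * norm (z * a3)"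
        by (simp add: algebra_simps)
      also have "r * norm (z * a1) \<le> \<alpha> * (2 * (2 + \<beta>))"
      proof -
        have "r * norm (z * a1) = \<alpha> * ((1 - (norm (e * z))\<^sup>2) * norm (e * z * deriv L (e * z)))"
          using \<alpha> \<open>norm e = 1\<close> by (simp add: r_def a1_def norm_mult)
        also have "\<dots> \<le> \<alpha> * (2 * (2 + \<beta>))"
          unfolding L_def using \<alpha> by (intro mult_left_mono C_base_log_derivative_bound[OF \<phi> \<delta> \<beta> ez[OF z]])
        finally show ?thesis .
      qed
      also have "r * norm (z * a2) \<le> k * X"
        unfolding r_def a2_def n_def X_def mult.assoc[symmetric, of k "hyperbolic_norm w"]
        by (rule dilatation_term_bound[OF holw w z k c])
      also have "r * norm (z * a3) \<le> k * X"
        unfolding r_def a3_def m_def X_def mult.assoc[symmetric, of k "hyperbolic_norm w"]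
        by (rule dilatation_term_bound[OF holw w z k]) simp_all
      finally have "r * norm (z * (a1 + c * a2 + a3)) \<le> 1"
        using budget by linarith
      then have "norm (deriv f z) * (r * norm (z * (a1 + c * a2 + a3))) \<le> norm (deriv f z) * 1"
        by (rule mult_left_mono) simp
      then show "(1 - (norm z)\<^sup>2) * norm (z * deriv (deriv f) z) \<le> norm (deriv f z)"
        by (simp add: ddf r_def norm_mult mult_ac)
    qed
    then show ?thesis
      by (simp add: f_def)
  qed
  then have "inj_on (\<lambda>z. H z + \<mu> * cnj (G z)) \<D>" if "\<mu> \<in> \<T>" for \<mu>
    using that by (intro stable_injectivity) auto
  then show ?thesis
    using decomp assms(11) unfolding SHU_def by blast
qed

end
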